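(* Let $k\in\mathbb N$. If a graph $G$ contains a geodesic cycle of length $k$, then $G$ has a bramble of connected order at least $\lceil k/2\rceil+1$, and $\mathrm{ctw}(G)\ge\lceil k/2\rceil$.
   Context: Graphs are simple and undirected. A tree-decomposition of a graph $G=(V,E)$ is a pair $(T,(V_t)_{t\in T})$ of a tree $T$ and a family of vertex sets $V_t\subseteq V$ (its parts), indexed by the nodes of $T$, such that (T1) $V=\bigcup_t V_t$; (T2) for every edge of $G$ some $V_t$ contains both its ends; (T3) $V_{t_1}\cap V_{t_3}\subseteq V_{t_2}$ whenever $t_2$ lies on the path between $t_1$ and $t_3$ in $T$. Its width is $\max_t|V_t|-1$. A tree-decomposition is connected if each of its parts induces a connected subgraph of $G$. The connected tree-width $\mathrm{ctw}(G)$ is the minimum width of a connected tree-decomposition of $G$. A subgraph $H\subseteq G$ is geodesic if $d_H(x,y)=d_G(x,y)$ for all vertices $x,y$ of $H$, where $d$ denotes the length (number of edges) of a shortest path in the respective graph. A geodesic cycle is a cycle in $G$ that is a geodesic subgraph. A bramble in $G$ is a set of pairwise touching connected sets of vertices of $G$ (each non-empty and inducing a connected subgraph), where two vertex sets touch if they share a vertex or $G$ has an edge between them. A set of vertices covers (is a cover of) a bramble if it has a vertex in each of the bramble's sets. A connected cover is a cover that induces a connected subgraph of $G$. The connected order of a bramble is the least size of a connected cover of it. *)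

theory Defs
  imports "Graph_Theory.Graph_Theory" "HOL-Library.Extended_Nat"
begin

text \<open>
  Undirected simple graphs, finite or infinite, are symmetric loop-free digraphs whose arcs are
  pairs of vertices (locale \<open>pair_bidirected_digraph\<close>); each undirected edge is a pair of opposite
  arcs. Because of these, an arc walk \<open>u, v, u\<close> satisfies the predicate \<open>cycle\<close>, so cycles of the
  undirected graph are those of length at least 3. For the same reason the constant \<open>tree\<close> of
  Graph_Theory is not the notion of an undirected tree.
\<close>

definition undirected_tree :: "'t pair_pre_digraph \<Rightarrow> bool" where
  "undirected_tree T \<longleftrightarrow>
     pair_bidirected_digraph T \<and> connected (with_proj T) \<and>
     \<not> (\<exists>p. pre_digraph.cycle (with_proj T) p \<and> 3 \<le> length p)"

text \<open>\<open>C\<close> consists of exactly the vertices and edges of a single cycle with \<open>k\<close> edges.\<close>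

definition cycle_graph :: "nat \<Rightarrow> 'a pair_pre_digraph \<Rightarrow> bool" where
  "cycle_graph k C \<longleftrightarrow>
     3 \<le> k \<and>
     (\<exists>p. pre_digraph.cycle (with_proj C) p \<and> length p = k \<and>
          pverts C = fst ` set p \<and> parcs C = set p \<union> (set p)\<inverse>)"

text \<open>The distance is \<open>\<infinity>\<close> if there is no path.\<close>

definition gdist :: "'a pair_pre_digraph \<Rightarrow> 'a \<Rightarrow> 'a \<Rightarrow> enat" where
  "gdist G x y = (INF p \<in> {p. pre_digraph.apath (with_proj G) x p y}. enat (length p))"

definition geodesic :: "'a pair_pre_digraph \<Rightarrow> 'a pair_pre_digraph \<Rightarrow> bool" where
  "geodesic H G \<longleftrightarrow>
     subgraph (with_proj H) (with_proj G) \<and>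
     (\<forall>x \<in> pverts H. \<forall>y \<in> pverts H. gdist H x y = gdist G x y)"

text \<open>The constant \<open>connected\<close> includes non-emptiness.\<close>

definition connected_set :: "'a pair_pre_digraph \<Rightarrow> 'a set \<Rightarrow> bool" where
  "connected_set G U \<longleftrightarrow> U \<subseteq> pverts G \<and> connected (with_proj G \<restriction> U)"

definition set_size :: "'a set \<Rightarrow> enat" where
  "set_size U = (if finite U then enat (card U) else \<infinity>)"


definition tree_decomposition ::
    "'a pair_pre_digraph \<Rightarrow> 't pair_pre_digraph \<Rightarrow> ('t \<Rightarrow> 'a set) \<Rightarrow> bool" where
  "tree_decomposition G T V \<longleftrightarrow>
     undirected_tree T \<and>
     pverts G = (\<Union>t \<in> pverts T. V t) \<and>
     (\<forall>(u, v) \<in> parcs G. \<exists>t \<in> pverts T. u \<in> V t \<and> v \<in> V t) \<and>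
     (\<forall>t1 t2 t3 p. pre_digraph.apath (with_proj T) t1 p t3 \<longrightarrow>
        t2 \<in> set (pre_digraph.awalk_verts (with_proj T) t1 p) \<longrightarrow> V t1 \<inter> V t3 \<subseteq> V t2)"

definition connected_tree_decomposition ::
    "'a pair_pre_digraph \<Rightarrow> 't pair_pre_digraph \<Rightarrow> ('t \<Rightarrow> 'a set) \<Rightarrow> bool" where
  "connected_tree_decomposition G T V \<longleftrightarrow>
     tree_decomposition G T V \<and> (\<forall>t \<in> pverts T. connected_set G (V t))"

definition td_width :: "'t pair_pre_digraph \<Rightarrow> ('t \<Rightarrow> 'a set) \<Rightarrow> enat" where
  "td_width T V = (SUP t \<in> pverts T. set_size (V t)) - 1"

text \<open>
  HOL cannot quantify over all types of tree nodes inside a definition, so the node type is an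
  argument. Once \<open>'t\<close> is infinite and at least as large as the vertex set of \<open>G\<close> the value no
  longer depends on \<open>'t\<close>, and smaller types can only give larger values. A lower bound that
  holds for every \<open>'t\<close> thus bounds the width of all connected tree-decompositions.
  The value is \<open>\<infinity>\<close> if none has finite width, as may happen for infinite \<open>G\<close>.
\<close>

definition ctw :: "'t itself \<Rightarrow> 'a pair_pre_digraph \<Rightarrow> enat" where
  "ctw _ G =
     (INF (T, V) \<in> {(T :: 't pair_pre_digraph, V). connected_tree_decomposition G T V}.
        td_width T V)"


definition touching :: "'a pair_pre_digraph \<Rightarrow> 'a set \<Rightarrow> 'a set \<Rightarrow> bool" where
  "touching G A B \<longleftrightarrow> A \<inter> B \<noteq> {} \<or> (\<exists>a \<in> A. \<exists>b \<in> B. (a, b) \<in> parcs G)"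

definition bramble :: "'a pair_pre_digraph \<Rightarrow> 'a set set \<Rightarrow> bool" where
  "bramble G \<B> \<longleftrightarrow>
     (\<forall>B \<in> \<B>. connected_set G B) \<and> (\<forall>A \<in> \<B>. \<forall>B \<in> \<B>. touching G A B)"

definition connected_cover :: "'a pair_pre_digraph \<Rightarrow> 'a set set \<Rightarrow> 'a set \<Rightarrow> bool" where
  "connected_cover G \<B> X \<longleftrightarrow> connected_set G X \<and> (\<forall>B \<in> \<B>. X \<inter> B \<noteq> {})"

definition connected_order :: "'a pair_pre_digraph \<Rightarrow> 'a set set \<Rightarrow> enat" where
  "connected_order G \<B> = (INF X \<in> {X. connected_cover G \<B> X}. set_size X)"

end

theory Submission
  imports Defs "HOL-Number_Theory.Cong"
begin

text \<open>
  The bramble consists of the vertex sets of all arcs of the geodesic cycle with \<open>k div 2\<close> vertices.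
  A cover meets every such arc, so it contains three (possibly equal) vertices that cut the cycle
  into arcs of length at most \<open>k div 2\<close>; these arcs realise the distances in \<open>G\<close>. If the
  cover is connected, it contains a subdivided star spanning the three vertices, and each of its
  legs is used by two of the three connecting paths, so it has at least \<open>k / 2\<close> edges. For the
  tree-width, the tree nodes whose parts meet a given arc form a convex set, these sets intersect
  pairwise, and by the Helly property of trees some part covers the finite bramble. Finiteness of
  the bramble is what makes this work in infinite trees.
\<close>

section \<open>Connected vertex sets and paths inside them\<close>

lemma length_rev_path: "length (rev_path p) = length p"
  by (induct p) auto

context pair_bidirected_digraph
begin

lemma sym_rtrancl_on_parcs: "(u, v) \<in> rtrancl_on U (parcs G) \<Longrightarrow> (v, u) \<in> rtrancl_on U (parcs G)"
proof -
  have "sym (parcs G)" by (auto intro: symI arcs_symmetric)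
  then show "(u, v) \<in> rtrancl_on U (parcs G) \<Longrightarrow> (v, u) \<in> rtrancl_on U (parcs G)"
    by (meson rtrancl_on_sym symD)
qed

text \<open>As \<open>parcs G\<close> is symmetric, the symmetric closure inside
  \<open>connected\<close> adds no arcs. This turns connectivity of an induced subgraph into
  reachability along a relation restricted to \<open>U\<close>.\<close>

lemma connected_induce_iff:
  "connected (with_proj G \<restriction> U) \<longleftrightarrow> U \<noteq> {} \<and> (\<forall>u\<in>U. \<forall>v\<in>U. (u, v) \<in> rtrancl_on U (parcs G))"
proof -
  define R where "R = parcs (mk_symmetric (with_proj G \<restriction> U))"
  have R: "R = {e \<in> parcs G. fst e \<in> U \<and> snd e \<in> U}"
    unfolding R_def by (auto simp: parcs_mk_symmetric arcs_symmetric)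
  have "rtrancl_on U (parcs G) \<subseteq> rtrancl_on U R"
  proof (rule subrelI)
    fix a b assume "(a, b) \<in> rtrancl_on U (parcs G)"
    then show "(a, b) \<in> rtrancl_on U R"
      by (induct rule: rtrancl_on_induct) (auto simp: R intro: rtrancl_on_into_rtrancl_on)
  qed
  moreover have "rtrancl_on U R \<subseteq> rtrancl_on U (parcs G)"
    using rtrancl_on_mono[of R "parcs G" U U] by (auto simp: R)
  ultimately have "rtrancl_on U R = rtrancl_on U (parcs G)" by blast
  then show ?thesis
    unfolding connected_def strongly_connected_def reachable_def with_proj_simps
      pverts_mk_symmetric R_def[symmetric] by simp
qed

lemma connected_iff:
  "connected (with_proj G) \<longleftrightarrow>
     pverts G \<noteq> {} \<and> (\<forall>u\<in>pverts G. \<forall>v\<in>pverts G. (u, v) \<in> rtrancl_on (pverts G) (parcs G))"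
proof -
  have "with_proj G \<restriction> pverts G = with_proj G"
    by (auto simp: induce_subgraph_def with_proj_def intro: in_arcsD1 in_arcsD2)
  then show ?thesis using connected_induce_iff[of "pverts G"] by simp
qed

lemma rtrancl_on_awalk:
  assumes "awalk u p v" "set (awalk_verts u p) \<subseteq> U"
  shows "(u, v) \<in> rtrancl_on U (parcs G)"
  using assms
proof (induct p arbitrary: u)
  case Nil
  then show ?case by (auto simp: awalk_Nil_iff)
next
  case (Cons e p)
  then have e: "e \<in> parcs G" "u = fst e" "u \<in> U" and p: "awalk (snd e) p v"
    by (auto simp: awalk_Cons_iff)
  have "(snd e, v) \<in> rtrancl_on U (parcs G)"
    using Cons p by auto
  then show ?case
    using e converse_rtrancl_on_into_rtrancl_on[of u "snd e"] by simp
qed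

lemma apath_in_set:
  assumes "(u, v) \<in> rtrancl_on U (parcs G)" "U \<subseteq> pverts G"
  obtains p where "apath u p v" "set (awalk_verts u p) \<subseteq> U"
proof -
  have "\<exists>p. awalk u p v \<and> set (awalk_verts u p) \<subseteq> U"
    using assms(1)
  proof (induct rule: converse_rtrancl_on_induct)
    case base
    then show ?case using assms(2) by (intro exI[of _ "[]"]) (auto simp: awalk_Nil_iff)
  next
    case (step x y)
    then obtain p where "awalk y p v" "set (awalk_verts y p) \<subseteq> U" by blast
    with step show ?case by (intro exI[of _ "(x, y) # p"]) (auto simp: awalk_Cons_iff)
  qed
  then obtain p where p: "awalk u p v" "set (awalk_verts u p) \<subseteq> U" by blast
  have q: "apath u (awalk_to_apath p) v" using p(1) by (rule apath_awalk_to_apath)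
  have "set (awalk_verts u (awalk_to_apath p)) \<subseteq> set (awalk_verts u p)"
    using awalk_to_apath_subset[OF p(1)] set_awalk_verts[OF awalkI_apath[OF q]]
      set_awalk_verts[OF p(1)] by auto
  with p q show thesis by (blast intro: that)
qed

text \<open>\<open>w\<close> is the first vertex at which a path from \<open>z\<close> meets a path from \<open>x\<close> to \<open>y\<close>.\<close>

lemma tripod:
  assumes "U \<subseteq> pverts G"
    and "(x, y) \<in> rtrancl_on U (parcs G)" "(z, x) \<in> rtrancl_on U (parcs G)"
  obtains w p1 p2 q where
    "apath x p1 w" "apath w p2 y" "apath z q w"
    "apath x (p1 @ p2) y" "apath z (q @ p2) y" "apath z (q @ rev_path p1) x"
    "set (awalk_verts x (p1 @ p2)) \<subseteq> U" "set (awalk_verts z q) \<subseteq> U"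
    "set (awalk_verts x (p1 @ p2)) \<inter> set (awalk_verts z q) = {w}"
proof -
  obtain p where p: "apath x p y" "set (awalk_verts x p) \<subseteq> U"
    using apath_in_set[OF assms(2,1)] .
  obtain r where r: "apath z r x" "set (awalk_verts z r) \<subseteq> U"
    using apath_in_set[OF assms(3,1)] .
  have "x \<in> set (awalk_verts x p)" using p(1) by (rule hd_in_awalk_verts)
  moreover have "x \<in> set (awalk_verts z r)" using r(1) by (auto simp: apath_def)
  ultimately have "\<exists>v \<in> set (awalk_verts z r). v \<in> set (awalk_verts x p)" by blast
  then obtain xs w ys where dec: "awalk_verts z r = xs @ w # ys"
    and w: "w \<in> set (awalk_verts x p)" and xs: "\<forall>v \<in> set xs. v \<notin> set (awalk_verts x p)"
    using split_list_first_prop[of "awalk_verts z r" "\<lambda>v. v \<in> set (awalk_verts x p)"] by blast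
  have "cas z r x" using r(1) by (auto simp: apath_def)
  then obtain q r' where qr: "r = q @ r'" "cas z q w" "awalk_verts z q = xs @ [w]"
    using awalk_decomp_verts[OF _ dec] by metis
  have q: "apath z q w"
    using r(1) qr by (auto simp: apath_append_iff)
  have "awalk x p y" using p(1) by (rule awalkI_apath)
  then obtain p1 p2 where pp: "p = p1 @ p2" "awalk x p1 w" "awalk w p2 y"
    using awalk_decomp[OF _ w] by blast
  have p1: "apath x p1 w" and p2: "apath w p2 y"
    using p(1) pp by (auto simp: apath_append_iff)
  have sub: "set (awalk_verts x p1) \<union> set (awalk_verts w p2) = set (awalk_verts x p)"
    using set_awalk_verts_append[OF pp(2,3)] pp(1) by simp
  have meet: "set (awalk_verts x p) \<inter> set (awalk_verts z q) = {w}"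
    using qr(3) xs w by auto
  \<comment> \<open>Since \<open>q\<close> meets the path \<open>p\<close> only in its own end
    \<open>w\<close>, following it by any path within the vertices of \<open>p\<close> repeats no
    vertex. This is applied to \<open>p2\<close> and to \<open>p1\<close> reversed.\<close>
  have cat: "apath z (q @ s) v"
    if s: "apath w s v" "set (awalk_verts w s) \<subseteq> set (awalk_verts x p)" for s v
  proof -
    obtain ws where ws: "awalk_verts w s = w # ws"
      using s(1) by (cases s) (auto simp: apath_def awalk_Cons_iff)
    then have "w \<notin> set ws" using s(1) by (simp add: apath_def)
    moreover have "set ws \<subseteq> set (awalk_verts x p)" using s(2) ws by simp
    ultimately have "set (awalk_verts z q) \<inter> set (tl (awalk_verts w s)) = {}"
      using meet unfolding ws by auto
    moreover have "awlast z q = w" using qr(3) by simp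
    ultimately show ?thesis using q s(1) by (simp add: apath_append_iff)
  qed
  have "apath w (rev_path p1) x" using p1 by simp
  moreover have "set (awalk_verts w (rev_path p1)) = set (awalk_verts x p1)"
    using awalk_verts_rev_path[OF pp(2)] by simp
  ultimately have "apath z (q @ rev_path p1) x" using cat sub by blast
  moreover have "apath z (q @ p2) y" using cat[OF p2] sub by blast
  moreover have "set (awalk_verts z q) \<subseteq> U" using r(2) dec qr(3) by auto
  ultimately show thesis
    using that[of p1 w p2 q] p1 p2 q p pp(1) meet by simp
qed

text \<open>The legs \<open>p1\<close>, \<open>p2\<close>, \<open>q\<close> of the tripod share only
  \<open>w\<close>, so their lengths add up to at most \<open>card U - 1\<close>. Each leg lies on
  two of the three connecting paths, so \<open>a + b + c\<close> is at most twice that sum.\<close>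

lemma tripod_card:
  assumes "U \<subseteq> pverts G" "finite U"
    and "(x, y) \<in> rtrancl_on U (parcs G)" "(z, x) \<in> rtrancl_on U (parcs G)"
    and "\<And>r. apath x r y \<Longrightarrow> a \<le> length r"
    and "\<And>r. apath z r y \<Longrightarrow> b \<le> length r"
    and "\<And>r. apath z r x \<Longrightarrow> c \<le> length r"
  shows "a + b + c + 2 \<le> 2 * card U"
proof -
  obtain w p1 p2 q where
    pq: "apath z q w" "apath x (p1 @ p2) y" "apath z (q @ p2) y" "apath z (q @ rev_path p1) x"
    "set (awalk_verts x (p1 @ p2)) \<subseteq> U" "set (awalk_verts z q) \<subseteq> U"
    "set (awalk_verts x (p1 @ p2)) \<inter> set (awalk_verts z q) = {w}"
    by (rule tripod[OF assms(1,3,4)]) (rule that)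
  have card: "card (set (awalk_verts u r)) = Suc (length r)" if "apath u r v" for u r v
    using that distinct_card[of "awalk_verts u r"] by (simp add: apath_def length_awalk_verts)
  have "card (set (awalk_verts x (p1 @ p2)) \<union> set (awalk_verts z q)) + 1 =
      Suc (length (p1 @ p2)) + Suc (length q)"
    using card_Un_Int[of "set (awalk_verts x (p1 @ p2))" "set (awalk_verts z q)"]
      card[OF pq(2)] card[OF pq(1)] pq(7) by simp
  moreover have "card (set (awalk_verts x (p1 @ p2)) \<union> set (awalk_verts z q)) \<le> card U"
    using pq assms(2) by (intro card_mono) auto
  ultimately show ?thesis
    using assms(5)[OF pq(2)] assms(6)[OF pq(3)] assms(7)[OF pq(4)] by (simp add: length_rev_path)
qed

end

section \<open>Convex subsets of trees\<close>

text \<open>In a tree these are the vertex sets of subtrees, together with the empty set.\<close>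

definition path_convex :: "'t pair_pre_digraph \<Rightarrow> 't set \<Rightarrow> bool" where
  "path_convex T S \<longleftrightarrow> S \<subseteq> pverts T \<and>
     (\<forall>s \<in> S. \<forall>s' \<in> S. \<forall>p. pre_digraph.apath (with_proj T) s p s' \<longrightarrow>
        set (pre_digraph.awalk_verts (with_proj T) s p) \<subseteq> S)"

lemma path_convex_Int: "path_convex T A \<Longrightarrow> path_convex T B \<Longrightarrow> path_convex T (A \<inter> B)"
  unfolding path_convex_def by blast

context pair_bidirected_digraph
begin

lemma path_convex_pverts: "path_convex G (pverts G)"
  unfolding path_convex_def by (auto simp: apath_def)

text \<open>Pick \<open>x\<close>, \<open>y\<close>, \<open>z\<close> in the three pairwise
  intersections. The centre \<open>w\<close> of their tripod lies on all three connecting paths, and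
  each of these joins two points of one of the sets.\<close>

lemma path_convex_Int3:
  assumes "connected (with_proj G)" "path_convex G A" "path_convex G B" "path_convex G C"
    and "A \<inter> B \<noteq> {}" "B \<inter> C \<noteq> {}" "A \<inter> C \<noteq> {}"
  shows "A \<inter> B \<inter> C \<noteq> {}"
proof -
  obtain x y z where xyz: "x \<in> A" "x \<in> B" "y \<in> A" "y \<in> C" "z \<in> B" "z \<in> C"
    using assms(5-7) by blast
  have V: "A \<subseteq> pverts G" "B \<subseteq> pverts G" "C \<subseteq> pverts G"
    using assms(2-4) by (auto simp: path_convex_def)
  then have con: "(x, y) \<in> rtrancl_on (pverts G) (parcs G)" "(z, x) \<in> rtrancl_on (pverts G) (parcs G)"
    using assms(1) xyz unfolding connected_iff by blast+
  obtain w p1 p2 q where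
    w: "apath x p1 w" "apath z q w"
    "apath x (p1 @ p2) y" "apath z (q @ p2) y" "apath z (q @ rev_path p1) x"
    by (rule tripod[OF subset_refl con]) (rule that)
  have mem: "w \<in> set (awalk_verts u (r @ s))" if "apath u r w" "apath u (r @ s) v" for u r s v
  proof -
    have "awlast u r = w" using that(1) by (auto simp: apath_def)
    then have "w \<in> set (awalk_verts u r)" using last_in_set[OF awalk_verts_non_Nil[of u r]] by simp
    then show ?thesis using awalk_verts_append[OF awalkI_apath[OF that(2)]] by simp
  qed
  have "w \<in> A"
    using assms(2) xyz mem[OF w(1,3)] w(3) unfolding path_convex_def by fastforce
  moreover have "w \<in> C"
    using assms(4) xyz mem[OF w(2,4)] w(4) unfolding path_convex_def by fastforce
  moreover have "w \<in> B"
    using assms(3) xyz mem[OF w(2,5)] w(5) unfolding path_convex_def by fastforce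
  ultimately show ?thesis by blast
qed

text \<open>The set \<open>K\<close> accumulates the intersection taken so far. When
  \<open>A\<close> is absorbed into it, \<open>path_convex_Int3\<close> for
  \<open>K \<inter> A\<close>, \<open>K \<inter> S\<close>, \<open>K \<inter> S'\<close> restores
  the hypothesis on pairs.\<close>

lemma path_convex_Helly:
  assumes "connected (with_proj G)" "finite F" "\<forall>S \<in> F. path_convex G S"
    and "path_convex G K" "K \<noteq> {}" "\<forall>S \<in> F. \<forall>S' \<in> F. K \<inter> S \<inter> S' \<noteq> {}"
  shows "K \<inter> \<Inter>F \<noteq> {}"
  using assms(2-)
proof (induct F arbitrary: K rule: finite_induct)
  case empty
  then show ?case by simp
next
  case (insert A F)
  have "K \<inter> A \<inter> S \<inter> S' \<noteq> {}" if S: "S \<in> F" "S' \<in> F" for S S'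
  proof -
    have "path_convex G (K \<inter> A)" "path_convex G (K \<inter> S)" "path_convex G (K \<inter> S')"
      using insert.prems S by (auto intro: path_convex_Int)
    moreover have "K \<inter> A \<inter> S \<noteq> {}" "K \<inter> S \<inter> S' \<noteq> {}" "K \<inter> A \<inter> S' \<noteq> {}"
      using insert.prems(4) S by blast+
    then have "(K \<inter> A) \<inter> (K \<inter> S) \<noteq> {}" "(K \<inter> S) \<inter> (K \<inter> S') \<noteq> {}" "(K \<inter> A) \<inter> (K \<inter> S') \<noteq> {}"
      by blast+
    ultimately have "(K \<inter> A) \<inter> (K \<inter> S) \<inter> (K \<inter> S') \<noteq> {}"
      by (rule path_convex_Int3[OF assms(1)])
    then show ?thesis by blast
  qed
  moreover have "path_convex G (K \<inter> A)" "K \<inter> A \<noteq> {}"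
    using insert.prems by (auto intro: path_convex_Int)
  ultimately have "K \<inter> A \<inter> \<Inter>F \<noteq> {}"
    using insert.prems by (intro insert.hyps(3)) auto
  then show ?case by auto
qed

end

text \<open>Otherwise the two neighbours of \<open>t\<close> on the path would be joined by a path
  avoiding \<open>t\<close>, which closes up through \<open>t\<close> to a cycle.\<close>

lemma undirected_tree_separates:
  assumes "undirected_tree T" "pre_digraph.apath (with_proj T) s p s'"
    and "t \<in> set (pre_digraph.awalk_verts (with_proj T) s p)" "t \<noteq> s" "t \<noteq> s'"
  shows "(s, s') \<notin> rtrancl_on (pverts T - {t}) (parcs T)"
proof
  assume "(s, s') \<in> rtrancl_on (pverts T - {t}) (parcs T)" (is "_ \<in> ?R")
  interpret pair_bidirected_digraph T using assms(1) by (simp add: undirected_tree_def)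
  have p: "apath s p s'" "t \<in> set (awalk_verts s p)" using assms(2,3) by simp_all
  then obtain q r where qr: "p = q @ r" "awalk s q t" "awalk t r s'"
    using awalk_decomp[of s p s' t] by (auto simp: apath_def)
  have "q \<noteq> []" "r \<noteq> []" using qr assms(4,5) by (auto simp: awalk_Nil_iff)
  then obtain q' e f r' where q': "q = q' @ [e]" and r': "r = f # r'"
    by (metis rev_exhaust list.exhaust)
  obtain a where e: "e = (a, t)" "(a, t) \<in> parcs T" and aq: "awalk s q' a"
    using qr(2) q' by (cases e) (auto simp: awalk_Cons_iff awalk_Nil_iff)
  obtain b where f: "f = (t, b)" "(t, b) \<in> parcs T" and br: "awalk b r' s'"
    using qr(3) r' by (cases f) (auto simp: awalk_Cons_iff)
  have vp: "awalk_verts s p = awalk_verts s q' @ t # awalk_verts b r'"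
  proof -
    have *: "p = q' @ (a, t) # (t, b) # r'" using qr q' r' e f by simp
    have "awalk s p s'" using p(1) by (rule awalkI_apath)
    from this[unfolded *] have "awalk_verts s p = awalk_verts s q' @ tl (awalk_verts a ((a, t) # (t, b) # r'))"
      using aq * awalk_verts_append[of s q' "(a, t) # (t, b) # r'" s'] by simp
    then show ?thesis by simp
  qed
  have "distinct (awalk_verts s p)" using p(1) by (simp add: apath_def)
  with vp have nt: "t \<notin> set (awalk_verts s q')" "t \<notin> set (awalk_verts b r')"
    and disj: "set (awalk_verts s q') \<inter> set (awalk_verts b r') = {}" by auto
  have ab: "a \<noteq> b"
    using disj hd_in_awalk_verts(1)[OF br] aq by (metis IntI awalk_verts_non_Nil awlast_of_awalk
      emptyE last_in_set awalkE')
  \<comment> \<open>The pieces of \<open>p\<close> before and after \<open>t\<close> avoid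
    \<open>t\<close>. Combined with the assumed connection from \<open>s\<close> to
    \<open>s'\<close>, they link \<open>b\<close> to \<open>a\<close> without
    \<open>t\<close>.\<close>
  have "(s, a) \<in> ?R" using aq nt by (intro rtrancl_on_awalk) auto
  moreover have "(b, s') \<in> ?R" using br nt by (intro rtrancl_on_awalk) auto
  ultimately have "(b, a) \<in> ?R"
    using \<open>(s, s') \<in> ?R\<close> by (meson rtrancl_on_trans sym_rtrancl_on_parcs)
  then obtain c where c: "apath b c a" "set (awalk_verts b c) \<subseteq> pverts T - {t}"
    using apath_in_set[of b a "pverts T - {t}"] by blast
  \<comment> \<open>This gives the closed walk length at least 3 and so rules out the walk from
    \<open>t\<close> to a neighbour and straight back, which also satisfies
    \<open>cycle\<close>.\<close>
  have "c \<noteq> []" using c(1) ab by (auto simp: apath_def awalk_Nil_iff)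
  let ?z = "(t, b) # c @ [(a, t)]"
  have bc: "awalk b c a" using c(1) by (rule awalkI_apath)
  have aw: "awalk b (c @ [(a, t)]) t"
    using e(2) by (intro awalk_appendI[OF bc]) (auto simp: awalk_Cons_iff awalk_Nil_iff in_arcsD2)
  have "awalk t ?z t" using aw f(2) by (simp add: awalk_Cons_iff del: awalk_append_iff)
  moreover have "awalk_verts b (c @ [(a, t)]) = awalk_verts b c @ [t]"
    using awalk_verts_append[OF aw] by simp
  then have "distinct (tl (awalk_verts t ?z))"
    using c by (auto simp: apath_def)
  ultimately have "cycle ?z" unfolding cycle_def by blast
  moreover have "3 \<le> length ?z" using \<open>c \<noteq> []\<close> by (cases c) auto
  ultimately show False using assms(1) unfolding undirected_tree_def by blast
qed

section \<open>Tree-decompositions and finite brambles\<close>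

text \<open>Follow a walk in \<open>B\<close> from \<open>x\<close> to \<open>y\<close>. By (T3),
  nodes whose parts share a vertex of \<open>B\<close> are joined within the set; by (T2), each edge
  of the walk has a part containing both ends, where one vertex can be exchanged for the
  next.\<close>

lemma tree_decomposition_connected_nodes:
  assumes td: "tree_decomposition G T V"
    and "(x, y) \<in> rtrancl_on B (parcs G)" "s \<in> pverts T" "x \<in> V s" "s' \<in> pverts T" "y \<in> V s'"
  shows "(s, s') \<in> rtrancl_on {t \<in> pverts T. V t \<inter> B \<noteq> {}} (parcs T)"
proof -
  let ?N = "{t \<in> pverts T. V t \<inter> B \<noteq> {}}"
  have T: "undirected_tree T"
    and edge: "\<And>u v. (u, v) \<in> parcs G \<Longrightarrow> \<exists>t \<in> pverts T. u \<in> V t \<and> v \<in> V t"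
    and T3: "\<And>t1 t2 t3 p. pre_digraph.apath (with_proj T) t1 p t3 \<Longrightarrow>
        t2 \<in> set (pre_digraph.awalk_verts (with_proj T) t1 p) \<Longrightarrow> V t1 \<inter> V t3 \<subseteq> V t2"
    using td unfolding tree_decomposition_def by blast+
  interpret T: pair_bidirected_digraph T using T by (simp add: undirected_tree_def)
  have con: "\<And>r r'. r \<in> pverts T \<Longrightarrow> r' \<in> pverts T \<Longrightarrow> (r, r') \<in> rtrancl_on (pverts T) (parcs T)"
    using T T.connected_iff by (auto simp: undirected_tree_def)
  have common: "(r, r') \<in> rtrancl_on ?N (parcs T)"
    if r: "r \<in> pverts T" "r' \<in> pverts T" "v \<in> V r" "v \<in> V r'" and "v \<in> B" for r r' v
  proof -
    obtain p where p: "T.apath r p r'" "set (T.awalk_verts r p) \<subseteq> pverts T"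
      using T.apath_in_set[OF con subset_refl] r by metis
    have "set (T.awalk_verts r p) \<subseteq> ?N"
    proof
      fix t assume t: "t \<in> set (T.awalk_verts r p)"
      then have "V r \<inter> V r' \<subseteq> V t" using T3[OF p(1)] by simp
      then show "t \<in> ?N" using r p(2) t \<open>v \<in> B\<close> by auto
    qed
    then show ?thesis using p by (intro T.rtrancl_on_awalk) (auto simp: T.apath_def)
  qed
  show ?thesis using assms(2,5,6)
  proof (induct arbitrary: s' rule: rtrancl_on_induct)
    case base
    then show ?case using common[of s s' x] assms(3,4) by blast
  next
    case (step y z)
    obtain r where r: "r \<in> pverts T" "y \<in> V r" "z \<in> V r" using edge step(2) by blast
    then have "(s, r) \<in> rtrancl_on ?N (parcs T)" using step by blast
    moreover have "(r, s') \<in> rtrancl_on ?N (parcs T)" using common[of r s' z] r step by blast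
    ultimately show ?case by (rule rtrancl_on_trans)
  qed
qed

text \<open>A node on the path outside the set would separate \<open>s\<close> from
  \<open>s'\<close> in the tree, although the set itself connects them.\<close>

lemma path_convex_nodes:
  assumes "pair_bidirected_digraph G" and td: "tree_decomposition G T V" and B: "connected_set G B"
  shows "path_convex T {t \<in> pverts T. V t \<inter> B \<noteq> {}}" (is "path_convex T ?N")
  unfolding path_convex_def
proof (intro conjI ballI allI impI subsetI)
  interpret G: pair_bidirected_digraph G by fact
  have T: "undirected_tree T" using td by (simp add: tree_decomposition_def)
  then interpret T: pair_bidirected_digraph T by (simp add: undirected_tree_def)
  fix s s' p t
  assume s: "s \<in> ?N" "s' \<in> ?N" and p: "pre_digraph.apath (with_proj T) s p s'"
    and t: "t \<in> set (pre_digraph.awalk_verts (with_proj T) s p)"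
  show "t \<in> ?N"
  proof (rule ccontr)
    assume nt: "t \<notin> ?N"
    obtain x y where xy: "x \<in> V s" "x \<in> B" "y \<in> V s'" "y \<in> B" using s by blast
    then have "(x, y) \<in> rtrancl_on B (parcs G)"
      using B G.connected_induce_iff by (auto simp: connected_set_def)
    then have around: "(s, s') \<in> rtrancl_on ?N (parcs T)"
      using tree_decomposition_connected_nodes[OF td] xy s by blast
    have "?N \<subseteq> pverts T - {t}" using nt by blast
    from rtrancl_on_mono[OF subset_refl this around]
    have "(s, s') \<in> rtrancl_on (pverts T - {t}) (parcs T)" .
    moreover have "t \<noteq> s" "t \<noteq> s'" using s nt by auto
    ultimately show False using undirected_tree_separates[OF T p t] by blast
  qed
qed auto

text \<open>Touching sets meet a common part: by (T1) if they share a vertex, by (T2) if an edge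
  joins them. So the convex node sets \<open>N B\<close> intersect pairwise and the Helly property
  applies.\<close>

lemma tree_decomposition_covers_bramble:
  assumes G: "pair_bidirected_digraph G" and td: "tree_decomposition G T V"
    and br: "bramble G \<B>" and fin: "finite \<B>"
  shows "\<exists>t \<in> pverts T. \<forall>B \<in> \<B>. V t \<inter> B \<noteq> {}"
proof -
  interpret G: pair_bidirected_digraph G by fact
  define N where "N B = {t \<in> pverts T. V t \<inter> B \<noteq> {}}" for B
  have T: "undirected_tree T"
    and verts: "pverts G = (\<Union>t \<in> pverts T. V t)"
    and edge: "\<And>u v. (u, v) \<in> parcs G \<Longrightarrow> \<exists>t \<in> pverts T. u \<in> V t \<and> v \<in> V t"
    using td unfolding tree_decomposition_def by blast+
  interpret T: pair_bidirected_digraph T using T by (simp add: undirected_tree_def)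
  have con: "connected (with_proj T)" using T by (simp add: undirected_tree_def)
  have "pverts T \<inter> N A \<inter> N B \<noteq> {}" if AB: "A \<in> \<B>" "B \<in> \<B>" for A B
  proof -
    have "touching G A B" "A \<subseteq> pverts G"
      using br AB by (auto simp: bramble_def connected_set_def)
    then obtain a b where "a \<in> A" "b \<in> B" "a = b \<and> a \<in> pverts G \<or> (a, b) \<in> parcs G"
      unfolding touching_def by blast
    moreover from this obtain t where "t \<in> pverts T" "a \<in> V t" "b \<in> V t"
      using verts edge by blast
    ultimately show ?thesis by (auto simp: N_def)
  qed
  moreover have "\<forall>S \<in> N ` \<B>. path_convex T S"
    using path_convex_nodes[OF G td] br by (auto simp: N_def bramble_def)
  \<comment> \<open>The set of all nodes plays the role of \<open>K\<close>; its being non-empty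
    also settles the empty bramble.\<close>
  moreover have "pverts T \<noteq> {}" using con T.connected_iff by blast
  ultimately have "pverts T \<inter> \<Inter>(N ` \<B>) \<noteq> {}"
    using fin by (intro T.path_convex_Helly[OF con _ _ T.path_convex_pverts]) auto
  then show ?thesis by (auto simp: N_def)
qed

section \<open>Cycles indexed modulo their length\<close>

text \<open>All natural numbers serve as indices, so that an arc running past the starting vertex is
  still an interval of indices.\<close>

definition cycle_enum :: "nat \<Rightarrow> 'a pair_pre_digraph \<Rightarrow> (nat \<Rightarrow> 'a) \<Rightarrow> bool" where
  "cycle_enum k C c \<longleftrightarrow>
     (\<forall>i j. c i = c j \<longleftrightarrow> [i = j] (mod k)) \<and> pverts C = range c \<and>
     parcs C = range (\<lambda>j. (c j, c (Suc j))) \<union> range (\<lambda>j. (c (Suc j), c j))"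

lemma pcas_nth: "pcas u p v \<Longrightarrow> Suc i < length p \<Longrightarrow> snd (p ! i) = fst (p ! Suc i)"
proof (induct p arbitrary: u i)
  case (Cons e p)
  then show ?case by (cases i; cases p) auto
qed simp

lemma pcas_snd_last: "pcas u p v \<Longrightarrow> p \<noteq> [] \<Longrightarrow> snd (last p) = v"
  by (induct p arbitrary: u) auto

lemma cycle_graph_enum:
  assumes "cycle_graph k C"
  obtains c where "cycle_enum k C c"
proof -
  interpret pair_pre_digraph C .
  obtain p where k: "3 \<le> k" and cyc: "cycle p" and len: "length p = k"
    and V: "pverts C = fst ` set p" and E: "parcs C = set p \<union> (set p)\<inverse>"
    using assms unfolding cycle_graph_def by blast
  obtain u where u: "awalk u p u" "distinct (tl (awalk_verts u p))" "p \<noteq> []"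
    using cyc unfolding cycle_def by blast
  have cas: "pcas u p u" using u(1) unfolding awalk_def by simp
  have hd: "fst (hd p) = u" using cas u(3) by (cases p) auto
  have "awalk_verts u p = map fst p @ [u]"
    using u(3) pcas_snd_last[OF cas] awalk_verts_conv[of u p] by simp
  \<comment> \<open>The closed walk lists \<open>u\<close> first and last; dropping the first
    occurrence or the last one leaves the same vertices.\<close>
  then have "distinct (map fst p)" using u(2,3) hd by (cases p) auto
  then have dist: "fst (p ! i) = fst (p ! j) \<longleftrightarrow> i = j" if "i < k" "j < k" for i j
    using that len by (metis length_map nth_eq_iff_index_eq nth_map)
  define c where "c j = fst (p ! (j mod k))" for j
  have nxt: "snd (p ! (j mod k)) = c (Suc j)" for j
  \<comment> \<open>In the first case the arc is the last one of \<open>p\<close> and leads back to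
    \<open>u\<close>, the tail of the first arc.\<close>
  proof (cases "Suc (j mod k) = k")
    case True
    then have "p ! (j mod k) = last p" using len u(3) by (metis diff_Suc_1 last_conv_nth)
    moreover have "Suc j mod k = 0" using True by (simp add: mod_Suc)
    ultimately show ?thesis
      using pcas_snd_last[OF cas u(3)] hd u(3) by (simp add: c_def hd_conv_nth)
  next
    case False
    then have "Suc j mod k = Suc (j mod k)" by (simp add: mod_Suc)
    moreover have "Suc (j mod k) < k" using False k mod_less_divisor[of k j] by linarith
    ultimately show ?thesis using pcas_nth[OF cas, of "j mod k"] len by (simp add: c_def)
  qed
  have pj: "p ! (j mod k) = (c j, c (Suc j))" for j
    by (rule prod_eqI) (simp only: fst_conv c_def, simp only: snd_conv nxt)
  have "set p = (!) p ` {..<k}" using len by (auto simp: set_conv_nth)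
  also have "{..<k} = range (\<lambda>j. j mod k)"
    using k by (auto simp: image_iff) (metis mod_less)
  finally have sp: "set p = range (\<lambda>j. (c j, c (Suc j)))"
    unfolding image_image pj .
  have "c i = c j \<longleftrightarrow> [i = j] (mod k)" for i j
    using dist[of "i mod k" "j mod k"] k by (simp add: c_def cong_def)
  moreover have "pverts C = range c" unfolding V sp image_image by simp
  moreover have "(range (\<lambda>j. (c j, c (Suc j))))\<inverse> = range (\<lambda>j. (c (Suc j), c j))" by auto
  ultimately have "cycle_enum k C c"
    unfolding cycle_enum_def E sp by simp
  then show thesis by (rule that)
qed

locale enumerated_cycle =
  fixes k :: nat and C :: "'a pair_pre_digraph" and c :: "nat \<Rightarrow> 'a"
  assumes k3: "3 \<le> k" and enum: "cycle_enum k C c"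
begin

lemma c_eq_iff: "c i = c j \<longleftrightarrow> [i = j] (mod k)"
  using enum by (simp add: cycle_enum_def)

lemma c_add_k: "c (i + k) = c i"
  by (simp add: c_eq_iff cong_def)

lemma pverts_eq: "pverts C = range c"
  using enum by (simp add: cycle_enum_def)

lemma finite_pverts: "finite (pverts C)"
proof -
  have "c j \<in> c ` {..<k}" for j
    using k3 by (intro image_eqI[of _ _ "j mod k"]) (auto simp: c_eq_iff cong_def)
  then have "pverts C \<subseteq> c ` {..<k}" by (auto simp: pverts_eq)
  then show ?thesis by (rule finite_subset) simp
qed

lemma parcs_succ: "(c j, c (Suc j)) \<in> parcs C"
  using enum by (auto simp: cycle_enum_def)

lemma parcsE:
  assumes "e \<in> parcs C"
  obtains j where "e = (c j, c (Suc j))" | j where "e = (c (Suc j), c j)"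
  using assms enum unfolding cycle_enum_def by blast

text \<open>\<open>s\<close> and \<open>t\<close> count the forward and the backward steps of the walk.\<close>

lemma walk_steps:
  assumes "set q \<subseteq> parcs C" "pcas (c i) q (c j)"
  shows "\<exists>s t. s + t = length q \<and> [i + s = j + t] (mod k)"
  using assms
proof (induct q arbitrary: i)
  case Nil
  then show ?case by (auto simp: c_eq_iff)
next
  case (Cons e q)
  have "e \<in> parcs C" using Cons.prems by simp
  then show ?case
  proof (cases rule: parcsE)
    case (1 a)
    then have a: "[a = i] (mod k)" using Cons.prems by (simp flip: c_eq_iff)
    obtain s t where st: "s + t = length q" "[Suc a + s = j + t] (mod k)"
      using Cons.hyps[of "Suc a"] Cons.prems 1 by auto
    have "[i + Suc s = a + Suc s] (mod k)" by (rule cong_add[OF cong_sym[OF a] cong_refl])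
    then have "[i + Suc s = j + t] (mod k)" using st(2) by (simp add: cong_def)
    then show ?thesis using st(1) by (intro exI[of _ "Suc s"] exI[of _ t]) simp
  next
    case (2 a)
    then have a: "[Suc a = i] (mod k)" using Cons.prems by (simp flip: c_eq_iff)
    obtain s t where st: "s + t = length q" "[a + s = j + t] (mod k)"
      using Cons.hyps[of a] Cons.prems 2 by auto
    have "[i + s = Suc a + s] (mod k)" by (rule cong_add[OF cong_sym[OF a] cong_refl])
    moreover have "[Suc (a + s) = Suc (j + t)] (mod k)"
      using st(2) cong_add_rcancel_nat[of "a + s" 1 "j + t" k] by simp
    ultimately have "[i + s = j + Suc t] (mod k)" by (simp add: cong_def)
    then show ?thesis using st(1) by (intro exI[of _ s] exI[of _ "Suc t"]) simp
  qed
qed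

text \<open>By \<open>walk_steps\<close>, \<open>k\<close> divides \<open>a + t - s\<close>. For a
  walk with fewer than \<open>a\<close> steps this number would lie strictly between 0 and
  \<open>2 * a\<close>, hence strictly between 0 and \<open>k\<close>.\<close>

lemma walk_length:
  assumes "set q \<subseteq> parcs C" "pcas (c i) q (c (i + a))" "2 * a \<le> k"
  shows "a \<le> length q"
proof (rule ccontr)
  assume "\<not> a \<le> length q"
  moreover obtain s t where st: "s + t = length q" "[i + s = i + a + t] (mod k)"
    using walk_steps[OF assms(1,2)] by blast
  ultimately have lt: "s < a" "t < a" by linarith+
  have "[s = a + t] (mod k)" using st(2) by (simp add: add.assoc cong_add_lcancel_nat)
  then have "k dvd a + t - s" using lt cong_altdef_nat[of s "a + t" k] cong_sym by auto
  then have "k \<le> a + t - s" using lt by (intro dvd_imp_le) auto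
  then show False using lt assms(3) by linarith
qed

lemma gdist_ge: "2 * a \<le> k \<Longrightarrow> enat a \<le> gdist C (c i) (c (i + a))"
  unfolding gdist_def
  by (rule INF_greatest)
    (auto simp: pre_digraph.apath_def pre_digraph.awalk_def cas_with_proj_eq intro: walk_length)

text \<open>The length \<open>k div 2\<close> is large enough for any two arcs to touch, and small
  enough that consecutive vertices of a cover along the cycle are at most \<open>k div 2\<close>
  apart, the range where \<open>walk_length\<close> applies.\<close>

definition seg :: "nat \<Rightarrow> 'a set" where
  "seg i = c ` {i..<i + k div 2}"

end

lemma enat_le_minus_one: "enat (n + 1) \<le> x \<Longrightarrow> enat n \<le> x - 1"
  by (cases x) (simp_all add: one_enat_def)

section \<open>The bramble of half-length arcs of a geodesic cycle\<close>

locale geodesic_cycle = pair_bidirected_digraph G + enumerated_cycle k C c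
  for G :: "'a pair_pre_digraph" and k and C :: "'a pair_pre_digraph" and c +
  assumes geo: "geodesic C G"
begin

lemma parcs_sub: "parcs C \<subseteq> parcs G" and pverts_sub: "pverts C \<subseteq> pverts G"
  using geo by (auto simp: geodesic_def subgraph_def)

text \<open>Here the equality of distances in \<open>geodesic\<close> enters: it carries the bound
  for walks in \<open>C\<close> over to paths in \<open>G\<close>.\<close>

lemma apath_length:
  assumes "apath (c i) q (c (i + a))" "2 * a \<le> k"
  shows "a \<le> length q"
proof -
  have "enat a \<le> gdist G (c i) (c (i + a))"
    using gdist_ge[OF assms(2)] geo by (auto simp: geodesic_def pverts_eq)
  also have "\<dots> \<le> enat (length q)"
    unfolding gdist_def using assms(1) by (intro INF_lower) simp
  finally show ?thesis by simp
qed

lemma connected_seg: "connected_set G (seg i)"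
proof -
  have fwd: "(c a, c (a + n)) \<in> rtrancl_on (seg i) (parcs G)"
    if "i \<le> a" "a + n < i + k div 2" for a n
    using that(2)
  proof (induct n)
    case 0
    then show ?case using that(1) by (auto simp: seg_def)
  next
    case (Suc n)
    then have "c (Suc (a + n)) \<in> seg i" using that(1) unfolding seg_def by (intro imageI) simp
    then show ?case
      using Suc parcs_succ[of "a + n"] parcs_sub by (auto intro: rtrancl_on_into_rtrancl_on)
  qed
  have "(u, v) \<in> rtrancl_on (seg i) (parcs G)" if uv: "u \<in> seg i" "v \<in> seg i" for u v
  proof -
    obtain a b where ab: "u = c a" "v = c b" "i \<le> a" "a < i + k div 2" "i \<le> b" "b < i + k div 2"
      using uv by (auto simp: seg_def)
    show ?thesis
    proof (cases "a \<le> b")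
      case True
      then show ?thesis using fwd[of a "b - a"] ab by simp
    next
      case False
      then show ?thesis
        using fwd[of b "a - b"] ab by (intro sym_rtrancl_on_parcs[of v u]) simp
    qed
  qed
  moreover have "seg i \<noteq> {}" using k3 by (simp add: seg_def)
  moreover have "seg i \<subseteq> pverts G" using pverts_sub pverts_eq by (auto simp: seg_def)
  ultimately show ?thesis
    unfolding connected_set_def connected_induce_iff by blast
qed

lemma touching_sym: "touching G A B \<Longrightarrow> touching G B A"
  unfolding touching_def using arcs_symmetric by blast

text \<open>The first vertex of the second arc lies in the first arc or, if
  \<open>d = k div 2\<close>, directly follows its last vertex.\<close>

lemma touching_seg_near:
  assumes "[i + d = j] (mod k)" "d \<le> k div 2"
  shows "touching G (seg i) (seg j)"
proof -
  have j: "c (i + d) = c j" using assms(1) by (simp add: c_eq_iff)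
  have jj: "c j \<in> seg j" using k3 by (auto simp: seg_def)
  show ?thesis
  proof (cases "d < k div 2")
    case True
    then have "c (i + d) \<in> seg i" unfolding seg_def by (intro imageI) simp
    then show ?thesis using j jj by (auto simp: touching_def)
  next
    case False
    then obtain d' where d': "d = Suc d'" "d' < k div 2"
      using assms(2) k3 by (cases d) auto
    then have "c (i + d') \<in> seg i" unfolding seg_def by (intro imageI) simp
    moreover have "(c (i + d'), c j) \<in> parcs G"
      using parcs_succ[of "i + d'"] parcs_sub j d' by auto
    ultimately show ?thesis using jj by (auto simp: touching_def)
  qed
qed

text \<open>Going round the cycle, the offset is \<open>d\<close> from \<open>i\<close> to
  \<open>j\<close> and \<open>k - d\<close> from \<open>j\<close> to \<open>i\<close>; one of the
  two is at most \<open>k div 2\<close>.\<close>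

lemma touching_seg: "touching G (seg i) (seg j)"
proof -
  \<comment> \<open>Adding a multiple of \<open>k\<close> to \<open>j\<close> makes the difference
    to \<open>i\<close> a natural number.\<close>
  have "i \<le> j + i * k" using k3 by (simp add: trans_le_add2)
  then obtain e where e: "j + i * k = i + e" using le_Suc_ex by blast
  define d where "d = e mod k"
  have d: "[i + d = j] (mod k)" "d < k"
  proof -
    have "[i + d = i + e] (mod k)" unfolding d_def cong_def by (simp add: mod_simps)
    then show "[i + d = j] (mod k)" unfolding e[symmetric] by (simp add: cong_def)
    show "d < k" unfolding d_def using k3 by simp
  qed
  show ?thesis
  proof (cases "d \<le> k div 2")
    case True
    then show ?thesis using touching_seg_near[OF d(1)] by simp
  next
    case False
    have "[j + (k - d) = i + d + (k - d)] (mod k)"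
      using d(1) by (simp only: cong_add_rcancel_nat cong_sym_eq)
    then have "[j + (k - d) = i] (mod k)" using d(2) by (simp add: cong_def)
    moreover have "k - d \<le> k div 2" using False d(2) by linarith
    ultimately show ?thesis using touching_seg_near touching_sym by blast
  qed
qed

lemma bramble_segs: "bramble G (range seg)"
  unfolding bramble_def using connected_seg touching_seg by blast

lemma finite_segs: "finite (range seg)"
proof -
  have "range seg \<subseteq> Pow (pverts C)" by (auto simp: seg_def pverts_eq)
  then show ?thesis by (rule finite_subset) (simp add: finite_pverts)
qed

text \<open>Starting at a vertex \<open>c i\<close> of \<open>X\<close>, let \<open>a\<close> be the
  longest admissible step to a vertex of \<open>X\<close>, and \<open>b\<close> the step from there
  to the next one. By the choice of \<open>a\<close>, together they exceed \<open>k div 2\<close>,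
  so the remaining gap \<open>d\<close> is at most \<open>k div 2\<close>.\<close>

lemma cover_gaps:
  assumes "\<And>i. X \<inter> seg i \<noteq> {}"
  obtains i a b d where "c i \<in> X" "c (i + a) \<in> X" "c (i + a + b) \<in> X" "a + b + d = k"
    "a \<le> k div 2" "b \<le> k div 2" "d \<le> k div 2"
proof -
  let ?m = "k div 2"
  obtain i where i: "c i \<in> X" using assms[of 0] by (auto simp: seg_def)
  define A where "A = {a. a \<le> ?m \<and> c (i + a) \<in> X}"
  define a where "a = Max A"
  have A: "finite A" "0 \<in> A" using i by (auto simp: A_def)
  then have a: "a \<in> A" unfolding a_def by (intro Max_in) auto
  have amax: "x \<le> a" if "x \<in> A" for x unfolding a_def using A that by simp
  define P where "P b \<longleftrightarrow> 0 < b \<and> c (i + a + b) \<in> X" for b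
  \<comment> \<open>The arc that begins right after \<open>c (i + a)\<close> is met by
    \<open>X\<close>, which bounds the next step by \<open>k div 2\<close>.\<close>
  obtain x where "c x \<in> X" "Suc (i + a) \<le> x" "x < Suc (i + a) + ?m"
    using assms[of "Suc (i + a)"] by (auto simp: seg_def)
  then have x: "P (x - (i + a))" "x - (i + a) \<le> ?m" by (auto simp: P_def)
  have "a < k" using a k3 by (auto simp: A_def)
  \<comment> \<open>The return to \<open>c i\<close> itself is a candidate for \<open>b\<close>, so
    \<open>a + b \<le> k\<close> and the subtraction defining the third gap is exact.\<close>
  then have ka: "P (k - a)" using i c_add_k[of i] by (simp add: P_def)
  define b where "b = (LEAST b. P b)"
  have b: "P b" "b \<le> ?m" "b \<le> k - a"
    using LeastI[of P, OF ka] Least_le[of P, OF ka] Least_le[of P, OF x(1)] x(2)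
    by (auto simp: b_def)
  have "\<not> a + b \<le> ?m"
    using amax[of "a + b"] b(1) by (auto simp: A_def P_def add.assoc)
  then have "k - (a + b) \<le> ?m" by linarith
  then show thesis
    using that[of i a b "k - (a + b)"] i a b \<open>a < k\<close> by (auto simp: A_def P_def)
qed

text \<open>The three vertices from \<open>cover_gaps\<close> are joined within \<open>X\<close>,
  and paths in \<open>G\<close> between them are at least as long as the gaps, whose sum is
  \<open>k\<close>; \<open>tripod_card\<close> then counts.\<close>

lemma connected_cover_card:
  assumes "connected_set G X" "finite X" "\<And>i. X \<inter> seg i \<noteq> {}"
  shows "k + 2 \<le> 2 * card X"
proof -
  obtain i a b d where
    X: "c i \<in> X" "c (i + a) \<in> X" "c (i + a + b) \<in> X" and
    abd: "a + b + d = k" "a \<le> k div 2" "b \<le> k div 2" "d \<le> k div 2"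
    using cover_gaps[OF assms(3)] by metis
  \<comment> \<open>The third gap ends at index \<open>i + k\<close>, which names the vertex
    \<open>c i\<close> again.\<close>
  have "i + a + b + d = i + k" using abd(1) by simp
  then have ci: "c i = c (i + a + b + d)" by (simp only: c_add_k)
  have X': "X \<subseteq> pverts G" "\<And>u v. u \<in> X \<Longrightarrow> v \<in> X \<Longrightarrow> (u, v) \<in> rtrancl_on X (parcs G)"
    using assms(1) by (auto simp: connected_set_def connected_induce_iff)
  have "a + b + d + 2 \<le> 2 * card X"
  proof (rule tripod_card[OF X'(1) assms(2)])
    show "(c i, c (i + a)) \<in> rtrancl_on X (parcs G)"
      "(c (i + a + b), c i) \<in> rtrancl_on X (parcs G)" using X X'(2) by blast+
    show "a \<le> length r" if "apath (c i) r (c (i + a))" for r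
      using apath_length[OF that] abd(2) by simp
    show "b \<le> length r" if "apath (c (i + a + b)) r (c (i + a))" for r
      using apath_length[of "i + a" "rev_path r" b] that abd(3) by (simp add: length_rev_path)
    show "d \<le> length r" if "apath (c (i + a + b)) r (c i)" for r
      using apath_length[of "i + a + b" r d] that abd(4) ci by simp
  qed
  then show ?thesis using abd(1) by simp
qed

lemma connected_cover_size:
  assumes "connected_set G X" "\<And>i. X \<inter> seg i \<noteq> {}"
  shows "enat (nat \<lceil>real k / 2\<rceil> + 1) \<le> set_size X"
proof (cases "finite X")
  case True
  then have "k + 2 \<le> 2 * card X" using connected_cover_card assms by blast
  then have "nat \<lceil>real k / 2\<rceil> + 1 \<le> card X" by linarith
  then show ?thesis using True by (simp add: set_size_def)
qed (simp add: set_size_def)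

lemma connected_order_segs: "enat (nat \<lceil>real k / 2\<rceil> + 1) \<le> connected_order G (range seg)"
  unfolding connected_order_def
proof (rule INF_greatest)
  fix X assume "X \<in> {X. connected_cover G (range seg) X}"
  then show "enat (nat \<lceil>real k / 2\<rceil> + 1) \<le> set_size X"
    by (intro connected_cover_size) (auto simp: connected_cover_def)
qed

text \<open>The part that covers the bramble is connected, hence a connected cover; the
  \<open>- 1\<close> in the width absorbs the extra 1 in the bound on its size.\<close>

lemma ctw_ge: "enat (nat \<lceil>real k / 2\<rceil>) \<le> ctw TYPE('t) G"
  unfolding ctw_def
proof (rule INF_greatest, clarify)
  fix T :: "'t pair_pre_digraph" and V
  assume td: "connected_tree_decomposition G T V"
  then obtain t where t: "t \<in> pverts T" "\<forall>B \<in> range seg. V t \<inter> B \<noteq> {}"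
    using tree_decomposition_covers_bramble[OF pair_bidirected_digraph_axioms _ bramble_segs finite_segs]
    unfolding connected_tree_decomposition_def by blast
  have "connected_set G (V t)" using td t(1) by (simp add: connected_tree_decomposition_def)
  then have "enat (nat \<lceil>real k / 2\<rceil> + 1) \<le> set_size (V t)"
    using t(2) by (intro connected_cover_size) auto
  also have "\<dots> \<le> (SUP t \<in> pverts T. set_size (V t))" using t(1) by (rule SUP_upper)
  finally show "enat (nat \<lceil>real k / 2\<rceil>) \<le> td_width T V"
    unfolding td_width_def by (rule enat_le_minus_one)
qed

end

theorem lemma7p1:
  fixes G :: "'a pair_pre_digraph" and k :: nat
  assumes "pair_bidirected_digraph G"
    and "\<exists>C. cycle_graph k C \<and> geodesic C G"
  shows "(\<exists>\<B>. bramble G \<B> \<and> enat (nat \<lceil>real k / 2\<rceil> + 1) \<le> connected_order G \<B>) \<and>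
         enat (nat \<lceil>real k / 2\<rceil>) \<le> ctw TYPE('t) G"
proof -
  obtain C where C: "cycle_graph k C" "geodesic C G" using assms(2) by blast
  then obtain c where "cycle_enum k C c" using cycle_graph_enum by blast
  then interpret geodesic_cycle G k C c
    using assms(1) C by (intro geodesic_cycle.intro enumerated_cycle.intro geodesic_cycle_axioms.intro)
      (auto simp: cycle_graph_def)
  show ?thesis using bramble_segs connected_order_segs ctw_ge by blast
qed

end
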